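(* Let $(B,d)$ be a metric space and $f:B\to\mathbb{R}$ a function. The following conditions are equivalent, where in each of (a)–(d) the version with "some" and the version with "all" are both included among the equivalent conditions. (a) $f$ is the $\Phi$-boundary-limit of a continuous function $\overline{f}:B\times\mathbb{R}_{>0}\to\mathbb{R}$ for some (all) upper-bounded families $\Phi\subset(\mathrm{Gg},\le)$. (b) $f$ is the $\phi$-boundary-limit of a continuous function $\overline{f}:B\times\mathbb{R}_{>0}\to\mathbb{R}$ for some (all) $\phi\in\mathrm{Gg}$. (c) $f$ is the $\Phi$-limit of a sequence $(f_n)$ of continuous functions $B\to\mathbb{R}$ for some (all) upper-bounded families $\Phi\subset(\mathrm{Gg},\le)$. (d) $f$ is the $\phi$-limit of a sequence $(f_n)$ of continuous functions $B\to\mathbb{R}$ for some (all) $\phi\in\mathrm{Gg}$. (e) $f$ is Baire-1.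
   Context: **Gauges.** A (smallness) gauge is a germ at $0$ of continuous functions $\phi:[0,\varepsilon)\to\mathbb{R}_{\ge0}$ (some $\varepsilon>0$) with $\phi(0)=0$; two such functions define the same germ if they agree on some $[0,\varepsilon')$, $\varepsilon'>0$. $\mathrm{Gg}$ denotes the collection of gauges, ordered by $\phi\le\phi'$ iff $\phi(x)\le\phi'(x)$ for all sufficiently small $x\ge 0$. A family $\Phi\subset\mathrm{Gg}$ is upper-bounded if there is $\phi'\in\mathrm{Gg}$ with $\phi\le\phi'$ for all $\phi\in\Phi$. **Boundary limits.** Let $\Phi$ be a family of gauges. A function $\overline{f}:B\times\mathbb{R}_{>0}\to\mathbb{R}$ has $\Phi$-boundary-limit $f:B\to\mathbb{R}$ if for every $b\in B$ and $\phi\in\Phi$, $\overline{f}(b',t)\to f(b)$ as $(b',t)\to(b,0)$ within $W_{b,\phi}=\{(b',t)\in B\times\mathbb{R}_{>0} : t \text{ sufficiently small},\ d(b,b')\le\phi(t)\}$. That is, for every $b\in B$, $\phi\in\Phi$ and $\eta>0$ there is $\delta>0$ with $|\overline{f}(b',t)-f(b)|<\eta$ whenever $0<t<\delta$ and $d(b,b')\le\phi(t)$. **Sequential limits.** A sequence of functions $f_n:B\to\mathbb{R}$ ($n\geq 1$) has $\Phi$-limit $f$ if for every $b\in B$ and $\phi\in\Phi$, $f_n(b')\to f(b)$ as $(b',\tfrac1n)\to(b,0)$ within $W_{b,\phi}$. That is, for every $b\in B$, $\phi\in\Phi$ and $\eta>0$ there is $N$ with $|f_n(b')-f(b)|<\eta$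 whenever $n\ge N$ and $d(b,b')\le\phi(1/n)$. For singletons, "$\phi$-(boundary-)limit" means "$\{\phi\}$-(boundary-)limit". **Baire-1.** $f:B\to\mathbb{R}$ is Baire-1 if the preimage of every open set is $F_\sigma$ (a countable union of closed sets).
   Formalization: In the "some" versions of (a) and (c) the upper-bounded family Φ is required to be nonempty; for the empty family the limit condition is vacuous, so every function, even one that is not Baire-1, would satisfy them. *)

theory Defs
  imports "HOL-Analysis.Analysis"
begin

text \<open>
  Functions on \<open>[0,\<epsilon>)\<close> are represented by total functions \<^typ>\<open>real \<Rightarrow> real\<close>; the values
  outside a small interval \<open>[0,\<epsilon>)\<close> are arbitrary and are forgotten on passing to germs.
\<close>

definition gauge_fun :: "(real \<Rightarrow> real) \<Rightarrow> bool" where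
  "gauge_fun p \<longleftrightarrow>
     (\<exists>\<epsilon>>0. continuous_on {0..<\<epsilon>} p \<and> p 0 = 0 \<and> (\<forall>x\<in>{0..<\<epsilon>}. 0 \<le> p x))"

definition same_gauge_germ :: "(real \<Rightarrow> real) \<Rightarrow> (real \<Rightarrow> real) \<Rightarrow> bool" where
  "same_gauge_germ p q \<longleftrightarrow>
     gauge_fun p \<and> gauge_fun q \<and> (\<exists>\<epsilon>>0. \<forall>x\<in>{0..<\<epsilon>}. p x = q x)"

lemma part_equivp_same_gauge_germ: "part_equivp same_gauge_germ"
proof (rule part_equivpI)
  have "gauge_fun (\<lambda>_. 0)"
    unfolding gauge_fun_def by (intro exI[of _ 1]) auto
  then show "\<exists>p. same_gauge_germ p p"
    unfolding same_gauge_germ_def using zero_less_one by blast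
  show "symp same_gauge_germ"
    unfolding symp_def same_gauge_germ_def by metis
  show "transp same_gauge_germ"
  proof (rule transpI)
    fix p q r
    assume "same_gauge_germ p q" "same_gauge_germ q r"
    then obtain d e where "gauge_fun p" "gauge_fun r" "d > 0" "e > 0"
      and "\<forall>x\<in>{0..<d}. p x = q x" "\<forall>x\<in>{0..<e}. q x = r x"
      unfolding same_gauge_germ_def by blast
    then show "same_gauge_germ p r"
      unfolding same_gauge_germ_def by (auto intro!: exI[of _ "min d e"])
  qed
qed

text \<open>The type of smallness gauges, i.e. the collection \<open>Gg\<close>.\<close>

quotient_type smallness_gauge = "real \<Rightarrow> real" / partial: same_gauge_germ
  by (rule part_equivp_same_gauge_germ)

instantiation smallness_gauge :: order
begin

lift_definition less_eq_smallness_gauge :: "smallness_gauge \<Rightarrow> smallness_gauge \<Rightarrow> bool"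
  is "\<lambda>p q. \<exists>\<epsilon>>0. \<forall>x\<in>{0..<\<epsilon>}. p x \<le> q x"
proof -
  have *: "\<exists>\<epsilon>>0. \<forall>x\<in>{0..<\<epsilon>}. p' x \<le> q' x"
    if *: "same_gauge_germ p p'" "same_gauge_germ q q'" "\<exists>\<epsilon>>0. \<forall>x\<in>{0..<\<epsilon>}. p x \<le> q x"
    for p p' q q'
  proof -
    obtain a b c where "a > 0" "b > 0" "c > 0" "\<forall>x\<in>{0..<a}. p x = p' x"
      "\<forall>x\<in>{0..<b}. q x = q' x" "\<forall>x\<in>{0..<c}. p x \<le> q x"
      using * unfolding same_gauge_germ_def by blast
    then show ?thesis
      by (intro exI[of _ "min a (min b c)"]) (metis atLeastLessThan_iff min_less_iff_conj)
  qed
  show "\<And>p p' q q'. same_gauge_germ p p' \<Longrightarrow> same_gauge_germ q q' \<Longrightarrow>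
      (\<exists>\<epsilon>>0. \<forall>x\<in>{0..<\<epsilon>}. p x \<le> q x) = (\<exists>\<epsilon>>0. \<forall>x\<in>{0..<\<epsilon>}. p' x \<le> q' x)"
    using * part_equivp_symp[OF part_equivp_same_gauge_germ] by blast
qed

definition less_smallness_gauge :: "smallness_gauge \<Rightarrow> smallness_gauge \<Rightarrow> bool" where
  "less_smallness_gauge \<phi> \<psi> \<longleftrightarrow> \<phi> \<le> \<psi> \<and> \<not> \<psi> \<le> \<phi>"

instance
proof
  fix \<phi> \<psi> \<theta> :: smallness_gauge
  show "\<phi> < \<psi> \<longleftrightarrow> \<phi> \<le> \<psi> \<and> \<not> \<psi> \<le> \<phi>"
    by (rule less_smallness_gauge_def)
  show "\<phi> \<le> \<phi>"
    by transfer (auto intro: exI[of _ 1])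
  show "\<phi> \<le> \<theta>" if "\<phi> \<le> \<psi>" "\<psi> \<le> \<theta>"
    using that
  proof transfer
    fix p q r :: "real \<Rightarrow> real"
    assume "\<exists>\<epsilon>>0. \<forall>x\<in>{0..<\<epsilon>}. p x \<le> q x" "\<exists>\<epsilon>>0. \<forall>x\<in>{0..<\<epsilon>}. q x \<le> r x"
    then obtain a b where "a > 0" "b > 0"
      "\<forall>x\<in>{0..<a}. p x \<le> q x" "\<forall>x\<in>{0..<b}. q x \<le> r x" by blast
    then show "\<exists>\<epsilon>>0. \<forall>x\<in>{0..<\<epsilon>}. p x \<le> r x"
      by (intro exI[of _ "min a b"]) force
  qed
  show "\<phi> = \<psi>" if "\<phi> \<le> \<psi>" "\<psi> \<le> \<phi>"
    using that
  proof transfer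
    fix p q :: "real \<Rightarrow> real"
    assume germ: "same_gauge_germ p p" "same_gauge_germ q q"
      and "\<exists>\<epsilon>>0. \<forall>x\<in>{0..<\<epsilon>}. p x \<le> q x" "\<exists>\<epsilon>>0. \<forall>x\<in>{0..<\<epsilon>}. q x \<le> p x"
    then obtain a b where "a > 0" "b > 0"
      "\<forall>x\<in>{0..<a}. p x \<le> q x" "\<forall>x\<in>{0..<b}. q x \<le> p x" by blast
    then have "min a b > 0 \<and> (\<forall>x\<in>{0..<min a b}. p x = q x)"
      by (auto intro: antisym)
    then show "same_gauge_germ p q"
      using germ unfolding same_gauge_germ_def by blast
  qed
qed

end

text \<open>
  \<open>tends_along_gauge \<phi> F b l\<close>: \<open>F (b', t)\<close> tends to \<open>l\<close> as \<open>(b', t)\<close> tends to \<open>(b, 0)\<close> within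
  \<open>W\<^bsub>b,\<phi>\<^esub> = {(b', t). t > 0 sufficiently small, d b b' \<le> \<phi> t}\<close>. Since \<open>\<phi> t\<close> tends to \<open>0\<close> as \<open>t\<close>
  does, only \<open>t\<close> has to be made small. Only the values of \<open>F\<close> at \<open>t > 0\<close> matter.
\<close>

lift_definition tends_along_gauge ::
  "smallness_gauge \<Rightarrow> ('a::metric_space \<times> real \<Rightarrow> real) \<Rightarrow> 'a \<Rightarrow> real \<Rightarrow> bool"
  is "\<lambda>p F b l. \<forall>\<eta>>0. \<exists>\<delta>>0. \<forall>t b'. 0 < t \<and> t < \<delta> \<and> dist b b' \<le> p t \<longrightarrow> \<bar>F (b', t) - l\<bar> < \<eta>"
proof -
  have *: "\<forall>\<eta>>0. \<exists>\<delta>>0. \<forall>t b'. 0 < t \<and> t < \<delta> \<and> dist b b' \<le> q t \<longrightarrow> \<bar>F (b', t) - l\<bar> < \<eta>"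
    if germ: "same_gauge_germ p q"
      and lim: "\<forall>\<eta>>0. \<exists>\<delta>>0. \<forall>t b'. 0 < t \<and> t < \<delta> \<and> dist b b' \<le> p t \<longrightarrow> \<bar>F (b', t) - l\<bar> < \<eta>"
    for p q and F :: "'a \<times> real \<Rightarrow> real" and b l
  proof (intro allI impI)
    fix \<eta> :: real assume "\<eta> > 0"
    then obtain d where "d > 0"
      "\<forall>t b'. 0 < t \<and> t < d \<and> dist b b' \<le> p t \<longrightarrow> \<bar>F (b', t) - l\<bar> < \<eta>"
      using lim by blast
    moreover obtain e where "e > 0" "\<forall>x\<in>{0..<e}. p x = q x"
      using germ unfolding same_gauge_germ_def by blast
    ultimately show "\<exists>\<delta>>0. \<forall>t b'. 0 < t \<and> t < \<delta> \<and> dist b b' \<le> q t \<longrightarrow> \<bar>F (b', t) - l\<bar> < \<eta>"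
      by (intro exI[of _ "min d e"]) auto
  qed
  show "\<And>p q. same_gauge_germ p q \<Longrightarrow>
      (\<lambda>(F :: 'a \<times> real \<Rightarrow> real) b l. \<forall>\<eta>>0. \<exists>\<delta>>0. \<forall>t b'. 0 < t \<and> t < \<delta> \<and> dist b b' \<le> p t \<longrightarrow> \<bar>F (b', t) - l\<bar> < \<eta>) =
      (\<lambda>F b l. \<forall>\<eta>>0. \<exists>\<delta>>0. \<forall>t b'. 0 < t \<and> t < \<delta> \<and> dist b b' \<le> q t \<longrightarrow> \<bar>F (b', t) - l\<bar> < \<eta>)"
    using * part_equivp_symp[OF part_equivp_same_gauge_germ] by (intro ext iffI) blast+
qed

definition has_boundary_limit ::
  "smallness_gauge set \<Rightarrow> ('a::metric_space \<times> real \<Rightarrow> real) \<Rightarrow> ('a \<Rightarrow> real) \<Rightarrow> bool" where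
  "has_boundary_limit \<Phi> F f \<longleftrightarrow> (\<forall>b. \<forall>\<phi>\<in>\<Phi>. tends_along_gauge \<phi> F b (f b))"

text \<open>
  Sequences are indexed by \<open>n \<ge> 1\<close>; the term at index \<open>0\<close> is ignored throughout.
\<close>

lift_definition seq_tends_along_gauge ::
  "smallness_gauge \<Rightarrow> (nat \<Rightarrow> 'a::metric_space \<Rightarrow> real) \<Rightarrow> 'a \<Rightarrow> real \<Rightarrow> bool"
  is "\<lambda>p F b l. \<forall>\<eta>>0. \<exists>N\<ge>1. \<forall>n b'. N \<le> n \<and> dist b b' \<le> p (1 / real n) \<longrightarrow> \<bar>F n b' - l\<bar> < \<eta>"
proof -
  have *: "\<forall>\<eta>>0. \<exists>N\<ge>1. \<forall>n b'. N \<le> n \<and> dist b b' \<le> q (1 / real n) \<longrightarrow> \<bar>F n b' - l\<bar> < \<eta>"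
    if germ: "same_gauge_germ p q"
      and lim: "\<forall>\<eta>>0. \<exists>N\<ge>1. \<forall>n b'. N \<le> n \<and> dist b b' \<le> p (1 / real n) \<longrightarrow> \<bar>F n b' - l\<bar> < \<eta>"
    for p q and F :: "nat \<Rightarrow> 'a \<Rightarrow> real" and b l
  proof (intro allI impI)
    fix \<eta> :: real assume "\<eta> > 0"
    then obtain N where N: "N \<ge> 1"
      "\<forall>n b'. N \<le> n \<and> dist b b' \<le> p (1 / real n) \<longrightarrow> \<bar>F n b' - l\<bar> < \<eta>"
      using lim by blast
    obtain e where e: "e > 0" "\<forall>x\<in>{0..<e}. p x = q x"
      using germ unfolding same_gauge_germ_def by blast
    obtain M where M: "M > 0" "1 / real M < e"
      using real_arch_inverse[of e] e(1) by (auto simp: inverse_eq_divide)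
    have "p (1 / real n) = q (1 / real n)" if "n \<ge> M" for n
    proof -
      have "1 / real n \<le> 1 / real M"
        using that M(1) by (intro divide_left_mono) auto
      then have "1 / real n \<in> {0..<e}"
        using M(2) by auto
      then show ?thesis
        using e(2) by blast
    qed
    then show "\<exists>N\<ge>1. \<forall>n b'. N \<le> n \<and> dist b b' \<le> q (1 / real n) \<longrightarrow> \<bar>F n b' - l\<bar> < \<eta>"
      using N by (intro exI[of _ "max N M"]) auto
  qed
  show "\<And>p q. same_gauge_germ p q \<Longrightarrow>
      (\<lambda>(F :: nat \<Rightarrow> 'a \<Rightarrow> real) b l. \<forall>\<eta>>0. \<exists>N\<ge>1. \<forall>n b'. N \<le> n \<and> dist b b' \<le> p (1 / real n) \<longrightarrow> \<bar>F n b' - l\<bar> < \<eta>) =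
      (\<lambda>F b l. \<forall>\<eta>>0. \<exists>N\<ge>1. \<forall>n b'. N \<le> n \<and> dist b b' \<le> q (1 / real n) \<longrightarrow> \<bar>F n b' - l\<bar> < \<eta>)"
    using * part_equivp_symp[OF part_equivp_same_gauge_germ] by (intro ext iffI) blast+
qed

definition has_seq_limit ::
  "smallness_gauge set \<Rightarrow> (nat \<Rightarrow> 'a::metric_space \<Rightarrow> real) \<Rightarrow> ('a \<Rightarrow> real) \<Rightarrow> bool" where
  "has_seq_limit \<Phi> F f \<longleftrightarrow> (\<forall>b. \<forall>\<phi>\<in>\<Phi>. seq_tends_along_gauge \<phi> F b (f b))"

definition is_boundary_limit_of_continuous ::
  "smallness_gauge set \<Rightarrow> ('a::metric_space \<Rightarrow> real) \<Rightarrow> bool" where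
  "is_boundary_limit_of_continuous \<Phi> f \<longleftrightarrow>
     (\<exists>F. continuous_on (UNIV \<times> {0<..}) F \<and> has_boundary_limit \<Phi> F f)"

definition is_seq_limit_of_continuous ::
  "smallness_gauge set \<Rightarrow> ('a::metric_space \<Rightarrow> real) \<Rightarrow> bool" where
  "is_seq_limit_of_continuous \<Phi> f \<longleftrightarrow>
     (\<exists>F. (\<forall>n\<ge>1. continuous_on UNIV (F n)) \<and> has_seq_limit \<Phi> F f)"

definition Baire_1 :: "('a::metric_space \<Rightarrow> real) \<Rightarrow> bool" where
  "Baire_1 f \<longleftrightarrow> (\<forall>U. open U \<longrightarrow> fsigma (f -` U))"

end

theory Submission
  imports Defs
begin

text \<open>
  Since \<open>b\<close> itself lies within distance \<open>\<phi> t\<close> of \<open>b\<close>, a limit along a gauge is in particular a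
  pointwise limit of continuous functions, hence Baire-1.

  Conversely fix a gauge \<open>p\<close>. For a closed set \<open>C\<close> the cut-off of \<open>2 - infdist x C / (p t + t)\<close> to
  \<open>[0, 1]\<close> has the indicator function of \<open>C\<close> as its boundary limit. Boundary limits
  are limits along filters, so they pass to normally convergent series and to quotients. If the
  closed sets \<open>C i\<close> cover the space and \<open>f\<close> is within \<open>e\<close> of a constant \<open>c i\<close> on each of them, then
  an average of the \<open>c i\<close>, weighted by these indicators, is a boundary limit within \<open>e\<close> of \<open>f\<close>.
  Applying this with \<open>e = 2\<^sup>-\<^sup>n\<close> and telescoping yields \<open>f\<close>.
\<close>

section \<open>Pointwise limits of continuous functions\<close>

lemma fsigma_UN_nat_nat:
  assumes "\<And>i j. closed (A (i :: nat) (j :: nat))"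
  shows "fsigma (\<Union>i j. A i j)"
proof -
  have "(\<Union>i j. A i j) = (\<Union>n. case_prod A (prod_decode n))"
    by auto (metis prod_encode_inverse case_prod_conv)
  moreover have "closed (case_prod A (prod_decode n))" for n
    using assms by (simp split: prod.split)
  ultimately show ?thesis
    by (metis fsigma.intros)
qed

text \<open>Let \<open>h\<close> be the distance to the complement of \<open>U\<close>, so that
  \<open>U\<close> is where \<open>h > 0\<close>. Then \<open>f x\<close> lies in \<open>U\<close>
  iff, for some \<open>k\<close>, eventually \<open>h (F n x)\<close> is at least
  \<open>1 / (k + 1)\<close>. The weak inequality survives the limit and defines closed sets, and
  only countably many pairs \<open>k\<close>, \<open>N\<close> occur.\<close>

lemma Baire_1_pointwise_limit:
  fixes f :: "'a::metric_space \<Rightarrow> real"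
  assumes cont: "\<And>n :: nat. continuous_on UNIV (F n)"
    and lim: "\<And>x. (\<lambda>n. F n x) \<longlonglongrightarrow> f x"
  shows "Baire_1 f"
  unfolding Baire_1_def
proof (intro allI impI)
  fix U :: "real set" assume "open U"
  show "fsigma (f -` U)"
  \<comment> \<open>The distance to the empty set is 0 by convention, so for \<open>U = UNIV\<close>
    the function \<open>h\<close> would not detect membership.\<close>
  proof (cases "U = UNIV")
    case True
    then show ?thesis
      using fsigma_UN_nat_nat[of "\<lambda>_ _. UNIV :: 'a set"] by simp
  next
    case False
    define h where "h y = infdist y (- U)" for y
    have U: "y \<in> U \<longleftrightarrow> h y > 0" for y
      using in_closed_iff_infdist_zero[of "- U" y] \<open>open U\<close> False infdist_nonneg[of y "- U"]
      by (auto simp: h_def closed_Compl less_le)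
    have h_lim: "(\<lambda>n. h (F n x)) \<longlonglongrightarrow> h (f x)" for x
      unfolding h_def by (intro tendsto_intros lim)
    have "x \<in> f -` U \<longleftrightarrow> (\<exists>k N. \<forall>n\<ge>N. 1 / real (Suc k) \<le> h (F n x))" for x
    proof
      assume "x \<in> f -` U"
      then have "h (f x) > 0" by (simp add: U)
      then obtain k where "1 / real (Suc k) < h (f x)"
        using nat_approx_posE by blast
      then have "\<forall>\<^sub>F n in sequentially. 1 / real (Suc k) < h (F n x)"
        using h_lim order_tendstoD(1) by blast
      then show "\<exists>k N. \<forall>n\<ge>N. 1 / real (Suc k) \<le> h (F n x)"
        unfolding eventually_sequentially by (meson less_imp_le)
    next
      assume "\<exists>k N. \<forall>n\<ge>N. 1 / real (Suc k) \<le> h (F n x)"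
      then obtain k N where "\<forall>n\<ge>N. 1 / real (Suc k) \<le> h (F n x)" by blast
      then have "1 / real (Suc k) \<le> h (f x)"
        using LIMSEQ_le_const[OF h_lim] by blast
      then show "x \<in> f -` U"
        by (simp add: U) (smt (verit) divide_pos_pos of_nat_0_le_iff)
    qed
    then have eq: "f -` U = (\<Union>k N. \<Inter>n\<in>{N..}. {x. 1 / real (Suc k) \<le> h (F n x)})"
      by (intro set_eqI) (simp only: UN_iff INT_iff mem_Collect_eq atLeast_iff Ball_def UNIV_I simp_thms bex_UNIV)
    have "closed {x. 1 / real (Suc k) \<le> h (F n x)}" for k n
      unfolding h_def by (intro closed_Collect_le continuous_intros cont)
    then show ?thesis
      unfolding eq by (intro fsigma_UN_nat_nat closed_INT) blast
  qed
qed

section \<open>Boundary limits as limits along a filter\<close>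

definition gauge_filter :: "(real \<Rightarrow> real) \<Rightarrow> 'a::metric_space \<Rightarrow> ('a \<times> real) filter" where
  "gauge_filter p b =
     inf (filtercomap snd (at_right 0)) (principal {z. dist b (fst z) \<le> p (snd z)})"

lemma eventually_gauge_filter:
  "eventually P (gauge_filter p b) \<longleftrightarrow>
     (\<exists>\<delta>>0. \<forall>t b'. 0 < t \<and> t < \<delta> \<and> dist b b' \<le> p t \<longrightarrow> P (b', t))"
proof -
  have "eventually P (gauge_filter p b) \<longleftrightarrow>
      (\<forall>\<^sub>F t in at_right 0. \<forall>b'. dist b b' \<le> p t \<longrightarrow> P (b', t))"
    unfolding gauge_filter_def eventually_inf_principal eventually_filtercomap
    by (auto elim: eventually_mono)
  then show ?thesis
    unfolding eventually_at_right_field by auto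
qed

text \<open>The right-hand side is the body of \<open>tends_along_gauge\<close> for a representative
  \<open>p\<close>, which makes the library of filter limits available for gauges.\<close>

lemma tendsto_gauge_filter:
  fixes l :: real
  shows "(F \<longlongrightarrow> l) (gauge_filter p b) \<longleftrightarrow>
    (\<forall>\<eta>>0. \<exists>\<delta>>0. \<forall>t b'. 0 < t \<and> t < \<delta> \<and> dist b b' \<le> p t \<longrightarrow> \<bar>F (b', t) - l\<bar> < \<eta>)"
  by (simp add: tendsto_iff eventually_gauge_filter dist_real_def)

lemma eventually_gauge_filter_pos: "\<forall>\<^sub>F z in gauge_filter p b. z \<in> UNIV \<times> {0<..}"
  unfolding eventually_gauge_filter by (auto intro: exI[of _ 1])

lemma tendsto_snd_gauge_filter: "(snd \<longlongrightarrow> 0) (gauge_filter p b)"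
  unfolding tendsto_gauge_filter by auto

definition continuous_limit ::
  "(real \<Rightarrow> real) \<Rightarrow> ('a::metric_space \<times> real \<Rightarrow> real) \<Rightarrow> ('a \<Rightarrow> real) \<Rightarrow> bool" where
  "continuous_limit p F f \<longleftrightarrow>
     continuous_on (UNIV \<times> {0<..}) F \<and> (\<forall>b. (F \<longlongrightarrow> f b) (gauge_filter p b))"

text \<open>By the Weierstrass test the partial sums converge uniformly on the whole region
  \<open>t > 0\<close>. Uniform convergence preserves continuity there and allows the sum to be
  exchanged with the limit along the filter.\<close>

lemma continuous_limit_suminf:
  assumes F: "\<And>n :: nat. continuous_limit p (F n) (f n)"
    and M: "summable M" "\<And>n z. \<bar>F n z\<bar> \<le> M n" "\<And>n b. \<bar>f n b\<bar> \<le> M n"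
  shows "continuous_limit p (\<lambda>z. \<Sum>n. F n z) (\<lambda>b. \<Sum>n. f n b)"
proof -
  have unif: "uniform_limit (UNIV \<times> {0<..}) (\<lambda>N z. \<Sum>n<N. F n z) (\<lambda>z. \<Sum>n. F n z) sequentially"
    by (rule Weierstrass_m_test[where M = M]) (use M in auto)
  have "((\<lambda>z. \<Sum>n. F n z) \<longlongrightarrow> (\<Sum>n. f n b)) (gauge_filter p b)" for b
  proof (rule swap_uniform_limit'[OF _ _ unif eventually_gauge_filter_pos])
    show "\<forall>\<^sub>F N in sequentially.
        ((\<lambda>z. \<Sum>n<N. F n z) \<longlongrightarrow> (\<Sum>n<N. f n b)) (gauge_filter p b)"
      using F by (intro always_eventually allI tendsto_sum) (auto simp: continuous_limit_def)
    have "summable (\<lambda>n. f n b)"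
      by (rule summable_comparison_test'[OF M(1)]) (use M(3) in auto)
    then show "(\<lambda>N. \<Sum>n<N. f n b) \<longlonglongrightarrow> (\<Sum>n. f n b)"
      by (rule summable_LIMSEQ)
  qed simp
  moreover have "continuous_on (UNIV \<times> {0<..}) (\<lambda>z. \<Sum>n. F n z)"
    using F by (intro uniform_limit_theorem[OF _ unif] always_eventually allI continuous_on_sum)
      (auto simp: continuous_limit_def)
  ultimately show ?thesis
    by (simp add: continuous_limit_def)
qed

lemma continuous_limit_add:
  assumes "continuous_limit p F f" "continuous_limit p G g"
  shows "continuous_limit p (\<lambda>z. F z + G z) (\<lambda>b. f b + g b)"
  using assms unfolding continuous_limit_def by (auto intro: continuous_on_add tendsto_add)

section \<open>Indicators of closed sets as boundary limits\<close>

definition nice_gauge :: "(real \<Rightarrow> real) \<Rightarrow> bool" where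
  "nice_gauge p \<longleftrightarrow> continuous_on {0<..} p \<and> (\<forall>t>0. 0 \<le> p t) \<and> (p \<longlongrightarrow> 0) (at_right 0)"

text \<open>Along the filter at \<open>b\<close>, the cut-off is eventually constant: 1 if
  \<open>b\<close> lies in \<open>C\<close>, and 0 if \<open>b\<close> has positive distance from
  \<open>C\<close>. The formula uses \<open>p\<close> at every \<open>t > 0\<close>, so
  \<open>nice_gauge\<close> asks for continuity and sign there and not only near 0. The summand
  \<open>t\<close> keeps the denominator positive where \<open>p\<close> vanishes.\<close>

lemma continuous_limit_indicator:
  fixes C :: "'a::metric_space set"
  assumes p: "nice_gauge p" and C: "closed C"
  obtains F where "continuous_limit p F (indicator C)" "\<And>z. 0 \<le> F z" "\<And>z. F z \<le> 1"
\<comment> \<open>For empty \<open>C\<close> the convention \<open>infdist x {} = 0\<close> would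
  turn the cut-off into the constant 1.\<close>
proof (cases "C = {}")
  case True
  show ?thesis
    by (rule that[of "\<lambda>_. 0"]) (auto simp: continuous_limit_def True)
next
  case False
  define F :: "'a \<times> real \<Rightarrow> real"
    where "F z = max 0 (min 1 (2 - infdist (fst z) C / (p (snd z) + snd z)))" for z
  have pos: "p t + t > 0" if "t > 0" for t
    using p that by (auto simp: nice_gauge_def intro: add_nonneg_pos)
  have cont_p: "continuous_on (UNIV \<times> {0<..}) (\<lambda>z :: 'a \<times> real. p (snd z))"
    using p by (auto simp: nice_gauge_def intro: continuous_on_compose2[OF _ continuous_on_snd])
  have "continuous_on (UNIV \<times> {0<..}) F"
    unfolding F_def using pos by (intro continuous_intros cont_p) fastforce
  moreover have "(F \<longlongrightarrow> indicator C b) (gauge_filter p b)" for b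
  proof (cases "b \<in> C")
    case True
    have "F (b', t) = 1" if "0 < t" "dist b b' \<le> p t" for b' t
    proof -
      have "infdist b' C \<le> p t + t"
        using infdist_le[OF True, of b'] that by (simp add: dist_commute)
      then show ?thesis
        using pos[OF that(1)] by (simp add: F_def)
    qed
    then have "\<forall>\<^sub>F z in gauge_filter p b. F z = 1"
      unfolding eventually_gauge_filter by (auto intro: exI[of _ 1])
    then show ?thesis
      using True by (simp add: tendsto_eventually)
  next
    case outside: False
    define r where "r = infdist b C"
    have "r > 0"
      using infdist_pos_not_in_closed[OF C False outside] by (simp add: r_def)
    \<comment> \<open>Here \<open>3 * p t + 2 * t\<close> is the sum of \<open>p t\<close>, the most
      by which the distance to \<open>C\<close> can drop between \<open>b\<close> and
      \<open>b'\<close>, and \<open>2 * (p t + t)\<close>, the distance from which on the cut-off is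
      0.\<close>
    have "((\<lambda>t. 3 * p t + 2 * t) \<longlongrightarrow> 3 * 0 + 2 * 0) (at_right 0)"
      using p by (intro tendsto_intros) (auto simp: nice_gauge_def)
    then have "\<forall>\<^sub>F t in at_right 0. 3 * p t + 2 * t < r"
      using \<open>r > 0\<close> order_tendstoD(2) by fastforce
    then obtain \<delta> where \<delta>: "\<delta> > 0" "\<And>t. 0 < t \<Longrightarrow> t < \<delta> \<Longrightarrow> 3 * p t + 2 * t < r"
      unfolding eventually_at_right_field by auto
    have "F (b', t) = 0" if t: "0 < t" "t < \<delta>" "dist b b' \<le> p t" for b' t
    proof -
      have "r \<le> infdist b' C + dist b b'"
        unfolding r_def by (rule infdist_triangle)
      then have "2 * (p t + t) \<le> infdist b' C"
        using \<delta>(2)[OF t(1,2)] t(3) by argo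
      then show ?thesis
        using pos[OF t(1)] by (simp add: F_def pos_le_divide_eq)
    qed
    then have "\<forall>\<^sub>F z in gauge_filter p b. F z = 0"
      unfolding eventually_gauge_filter using \<delta>(1) by auto
    then show ?thesis
      using outside by (simp add: tendsto_eventually)
  qed
  ultimately have "continuous_limit p F (indicator C)"
    by (simp add: continuous_limit_def)
  then show ?thesis
    by (rule that) (auto simp: F_def)
qed

section \<open>Approximation of Baire-1 functions by boundary limits\<close>

lemma Baire_1_closed_cover:
  fixes f :: "'a::metric_space \<Rightarrow> real"
  assumes f: "Baire_1 f" and "e > 0"
  obtains C :: "nat \<Rightarrow> 'a set" and c :: "nat \<Rightarrow> real"
  where "\<And>i. closed (C i)" "(\<Union>i. C i) = UNIV" "\<And>i x. x \<in> C i \<Longrightarrow> \<bar>f x - c i\<bar> < e"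
proof -
  \<comment> \<open>The balls of radius \<open>e\<close> about the rationals \<open>q n\<close>
    cover the line, and the preimage of each is a countable union of closed sets. The sets
    \<open>C i\<close> enumerate all these pieces through \<open>prod_decode\<close>, and
    \<open>c i\<close> is the centre of the ball that the piece comes from.\<close>
  define q where "q n = real_of_rat (nat_to_rat_surj n)" for n
  have "\<exists>A. (\<forall>k :: nat. closed (A k)) \<and> f -` ball (q j) e = (\<Union>k. A k)" for j
    using f unfolding Baire_1_def by (metis open_ball fsigma.cases)
  then obtain A where A: "\<And>j k :: nat. closed (A j k)" "\<And>j. f -` ball (q j) e = (\<Union>k. A j k)"
    by metis
  define C where "C n = case_prod A (prod_decode n)" for n
  define c where "c n = q (fst (prod_decode n))" for n
  show thesis
  proof (rule that[of C c])
    show "closed (C i)" for i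
      using A(1) by (simp add: C_def split: prod.split)
    show "\<bar>f x - c i\<bar> < e" if "x \<in> C i" for i x
    proof -
      obtain j k where jk: "prod_decode i = (j, k)" by fastforce
      then have "x \<in> f -` ball (q j) e"
        using that A(2) by (auto simp: C_def)
      then show ?thesis
        using jk by (simp add: c_def dist_real_def abs_minus_commute)
    qed
    have "\<exists>i. x \<in> C i" for x
    proof -
      obtain s where s: "f x < of_rat s" "of_rat s < f x + e"
        using of_rat_dense[of "f x" "f x + e"] \<open>e > 0\<close> by auto
      obtain j where "s = nat_to_rat_surj j"
        using surj_nat_to_rat_surj by (meson surjD)
      then have "x \<in> f -` ball (q j) e"
        using s by (auto simp: q_def dist_real_def)
      then obtain k where "x \<in> A j k"
        using A(2) by auto
      then show ?thesis
        by (intro exI[of _ "prod_encode (j, k)"]) (simp add: C_def)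
    qed
    then show "(\<Union>i. C i) = UNIV" by auto
  qed
qed

lemma continuous_limit_approx:
  fixes f :: "'a::metric_space \<Rightarrow> real"
  assumes p: "nice_gauge p" and f: "Baire_1 f" and "e > 0"
  obtains F h where "continuous_limit p F h" "\<And>b. \<bar>h b - f b\<bar> \<le> e"
proof -
  obtain C :: "nat \<Rightarrow> 'a set" and c where C: "\<And>i. closed (C i)" "(\<Union>i. C i) = UNIV"
    and c: "\<And>i x. x \<in> C i \<Longrightarrow> \<bar>f x - c i\<bar> < e"
    using Baire_1_closed_cover[OF f \<open>e > 0\<close>] by metis
  have "\<exists>A. continuous_limit p A (indicator (C i)) \<and> (\<forall>z. 0 \<le> A z \<and> A z \<le> 1)" for i
    using continuous_limit_indicator[OF p C(1)] by metis
  then obtain A where A: "\<And>i. continuous_limit p (A i) (indicator (C i))"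
    "\<And>i z. 0 \<le> A i z" "\<And>i z. A i z \<le> 1"
    by metis
  \<comment> \<open>The values \<open>c i\<close> may be unbounded; dividing by
    \<open>1 + \<bar>c i\<bar>\<close> bounds both \<open>w i\<close> and \<open>w i * c i\<close>
    by the same geometric sequence.\<close>
  define w where "w i = (1 / 2) ^ i / (1 + \<bar>c i\<bar>)" for i
  have w: "w i > 0" "\<bar>w i\<bar> \<le> (1 / 2) ^ i" "\<bar>w i * c i\<bar> \<le> (1 / 2) ^ i" for i
  proof -
    have "w i * (1 + \<bar>c i\<bar>) = (1 / 2) ^ i"
      by (simp add: w_def add_nonneg_eq_0_iff)
    moreover show "w i > 0"
      by (simp add: w_def add_pos_nonneg)
    ultimately have "w i + \<bar>w i * c i\<bar> = (1 / 2) ^ i"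
      by (simp add: abs_mult distrib_left)
    then show "\<bar>w i\<bar> \<le> (1 / 2) ^ i" "\<bar>w i * c i\<bar> \<le> (1 / 2) ^ i"
      using \<open>w i > 0\<close> by auto
  qed
  have geo: "summable (\<lambda>i. (1 / 2 :: real) ^ i)"
    by simp
  define I where "I i = (indicator (C i) :: 'a \<Rightarrow> real)" for i
  have I: "0 \<le> I i b" "I i b \<le> 1" for i b
    by (auto simp: I_def indicator_def)
  \<comment> \<open>Stated for general coefficients \<open>v\<close>, so as to serve for the
    numerator (\<open>v i = w i * c i\<close>) and the denominator (\<open>v i = w i\<close>) of the
    average.\<close>
  have lim: "continuous_limit p (\<lambda>z. \<Sum>i. v i * A i z) (\<lambda>b. \<Sum>i. v i * I i b)"
    if v: "\<And>i. \<bar>v i\<bar> \<le> (1 / 2) ^ i" for v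
  proof (rule continuous_limit_suminf[OF _ geo])
    have bound: "\<bar>v i * a\<bar> \<le> (1 / 2) ^ i" if "0 \<le> a" "a \<le> 1" for i a
      using mult_mono[OF v[of i] that(2)] that by (simp add: abs_mult)
    show "\<bar>v i * A i z\<bar> \<le> (1 / 2) ^ i" for i z
      by (rule bound) (rule A)+
    show "\<bar>v i * I i b\<bar> \<le> (1 / 2) ^ i" for i b
      by (rule bound) (rule I)+
    show "continuous_limit p (\<lambda>z. v i * A i z) (\<lambda>b. v i * I i b)" for i
      using A(1)[of i] unfolding continuous_limit_def I_def
      by (auto intro!: continuous_intros tendsto_intros)
  qed
  define N where "N z = (\<Sum>i. w i * c i * A i z)" for z
  define S where "S z = (\<Sum>i. w i * A i z)" for z
  define n where "n b = (\<Sum>i. w i * c i * I i b)" for b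
  define s where "s b = (\<Sum>i. w i * I i b)" for b
  have N: "continuous_limit p N n"
    unfolding N_def n_def by (rule lim) (rule w)
  have S: "continuous_limit p S s"
    unfolding S_def s_def by (rule lim) (rule w)
  have sum_s: "summable (\<lambda>i. w i * I i b)" for b
    by (rule summable_comparison_test'[OF geo])
      (use w(2) I in \<open>auto simp: abs_mult intro: order_trans[OF mult_left_le]\<close>)
  have sum_n: "summable (\<lambda>i. w i * c i * I i b)" for b
    by (rule summable_comparison_test'[OF geo])
      (use w(3) I in \<open>auto simp: abs_mult intro: order_trans[OF mult_left_le]\<close>)
  have s_pos: "s b > 0" for b
  proof -
    obtain i where "b \<in> C i" using C(2) by auto
    then have "0 < w i * I i b" using w(1) by (simp add: I_def)
    then show ?thesis
      unfolding s_def using sum_s w(1) I by (intro suminf_pos2) (auto simp: less_imp_le)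
  qed
  \<comment> \<open>The difference \<open>n b - f b * s b\<close> is the sum of
    \<open>w i * (c i - f b)\<close> over those \<open>i\<close> with \<open>b\<close> in
    \<open>C i\<close>, where \<open>c i\<close> is within \<open>e\<close> of
    \<open>f b\<close>.\<close>
  have approx: "\<bar>n b / s b - f b\<bar> \<le> e" for b
  proof -
    have "n b - f b * s b = (\<Sum>i. w i * c i * I i b - f b * (w i * I i b))"
      unfolding n_def s_def using sum_n sum_s
      by (subst suminf_diff[symmetric]) (auto simp: suminf_mult intro: summable_mult)
    also have "\<bar>\<dots>\<bar> \<le> (\<Sum>i. e * (w i * I i b))"
    proof -
      have "norm (w i * c i * I i b - f b * (w i * I i b)) \<le> e * (w i * I i b)" for i
      proof (cases "b \<in> C i")
        case True
        have "\<bar>w i * c i - f b * w i\<bar> = \<bar>f b - c i\<bar> * w i"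
          using w(1)[of i] by (simp add: abs_mult flip: right_diff_distrib abs_minus_commute mult.commute[of "w i"])
        also have "\<dots> \<le> e * w i"
          using c[OF True] w(1)[of i] by (intro mult_right_mono) auto
        finally show ?thesis using True by (simp add: I_def)
      qed (simp add: I_def)
      from norm_suminf_le[OF this summable_mult[OF sum_s]] show ?thesis
        by simp
    qed
    also have "\<dots> = e * s b"
      unfolding s_def by (rule suminf_mult) (rule sum_s)
    finally have "\<bar>n b - f b * s b\<bar> / s b \<le> e"
      using s_pos by (simp add: divide_le_eq)
    moreover have "n b / s b - f b = (n b - f b * s b) / s b"
      using s_pos[of b] by (simp add: diff_divide_distrib)
    ultimately show ?thesis
      using s_pos[of b] by (simp add: abs_divide)
  qed
  \<comment> \<open>\<open>S\<close> may vanish at some \<open>t > 0\<close>; replacing it by its maximum with \<open>t\<close> does not change the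
    boundary limit.\<close>
  have "continuous_limit p (\<lambda>z. N z / max (S z) (snd z)) (\<lambda>b. n b / s b)"
    unfolding continuous_limit_def
  proof (intro conjI allI)
    show "continuous_on (UNIV \<times> {0<..}) (\<lambda>z. N z / max (S z) (snd z))"
      using N S by (intro continuous_intros) (auto simp: continuous_limit_def max_def)
    fix b
    have "((\<lambda>z. N z / max (S z) (snd z)) \<longlongrightarrow> n b / max (s b) 0) (gauge_filter p b)"
      using N S s_pos[of b]
      by (intro tendsto_divide tendsto_max tendsto_snd_gauge_filter)
        (auto simp: continuous_limit_def max_def)
    then show "((\<lambda>z. N z / max (S z) (snd z)) \<longlongrightarrow> n b / s b) (gauge_filter p b)"
      using s_pos[of b] by (simp add: max_def)
  qed
  then show thesis
    using approx by (rule that)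
qed

text \<open>The limits \<open>h n\<close> converge uniformly to \<open>f\<close>, but this bounds
  the differences of consecutive \<open>F n\<close> only in the limit and not at each
  \<open>t > 0\<close>. Clamping these differences provides the bound that the series lemma
  requires, and leaves their boundary limits unchanged.\<close>

lemma Baire_1_continuous_limit:
  fixes f :: "'a::metric_space \<Rightarrow> real"
  assumes p: "nice_gauge p" and f: "Baire_1 f"
  obtains F where "continuous_limit p F f"
proof -
  define e :: "nat \<Rightarrow> real" where "e n = (1 / 2) ^ n" for n
  have "\<exists>F h. continuous_limit p F h \<and> (\<forall>b. \<bar>h b - f b\<bar> \<le> e n)" for n
    using continuous_limit_approx[OF p f, of "e n"] by (metis e_def zero_less_power half_gt_zero zero_less_one)
  then obtain F h where F: "\<And>n. continuous_limit p (F n) (h n)"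
    and h: "\<And>n b. \<bar>h n b - f b\<bar> \<le> e n"
    by metis
  \<comment> \<open>The level \<open>2 * e n\<close> bounds \<open>e (Suc n) + e n\<close>, and
    hence the distance between \<open>h (Suc n)\<close> and \<open>h n\<close>, so that
    \<open>clamp n\<close> fixes \<open>d n b\<close>.\<close>
  define clamp :: "nat \<Rightarrow> real \<Rightarrow> real" where "clamp n x = max (- 2 * e n) (min (2 * e n) x)" for n x
  define D where "D n z = clamp n (F (Suc n) z - F n z)" for n z
  define d where "d n b = h (Suc n) b - h n b" for n b
  have e: "e n \<ge> 0" "e (Suc n) \<le> e n" for n
    by (auto simp: e_def)
  have d: "\<bar>d n b\<bar> \<le> 2 * e n" for n b
    using h[of "Suc n" b] h[of n b] e(2)[of n] unfolding d_def by linarith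
  have clamp_d: "clamp n (d n b) = d n b" for n b
    using d[of n b] by (auto simp: clamp_def)
  have "continuous_limit p (\<lambda>z. \<Sum>n. D n z) (\<lambda>b. \<Sum>n. d n b)"
  proof (rule continuous_limit_suminf)
    show "summable (\<lambda>n. 2 * e n)"
      unfolding e_def by (intro summable_mult) simp
    show "\<bar>D n z\<bar> \<le> 2 * e n" for n z
      using e(1)[of n] by (auto simp: D_def clamp_def)
    show "\<bar>d n b\<bar> \<le> 2 * e n" for n b
      by (rule d)
    show "continuous_limit p (D n) (d n)" for n
      unfolding continuous_limit_def
    proof (intro conjI allI)
      show "continuous_on (UNIV \<times> {0<..}) (D n)"
        using F unfolding D_def clamp_def
        by (intro continuous_intros) (auto simp: continuous_limit_def)
      have "(D n \<longlongrightarrow> clamp n (d n b)) (gauge_filter p b)" for b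
        using F unfolding D_def d_def clamp_def
        by (intro tendsto_intros tendsto_max tendsto_min) (auto simp: continuous_limit_def)
      then show "(D n \<longlongrightarrow> d n b) (gauge_filter p b)" for b
        by (simp add: clamp_d)
    qed
  qed
  moreover have "(\<Sum>n. d n b) = f b - h 0 b" for b
  proof -
    have "(\<lambda>n. h n b - f b) \<longlonglongrightarrow> 0"
      by (rule Lim_null_comparison[where g = e]) (use h LIMSEQ_power_zero[of "1 / 2 :: real"] in \<open>auto simp: e_def[abs_def]\<close>)
    then have "(\<lambda>n. h n b) \<longlonglongrightarrow> f b"
      by (rule LIM_zero_cancel)
    then show ?thesis
      unfolding d_def by (intro sums_unique[symmetric] telescope_sums)
  qed
  \<comment> \<open>The series telescopes to \<open>f b - h 0 b\<close>; the summand
    \<open>F 0\<close> restores the missing \<open>h 0\<close>.\<close>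
  ultimately have "continuous_limit p (\<lambda>z. F 0 z + (\<Sum>n. D n z)) f"
    using continuous_limit_add[OF F[of 0]] by fastforce
  then show thesis
    by (rule that)
qed

section \<open>Limits along gauge germs\<close>

lemma gauge_fun_nice_representative:
  assumes "gauge_fun p"
  obtains q \<epsilon> where "nice_gauge q" "\<epsilon> > 0" "\<And>t. 0 \<le> t \<Longrightarrow> t < \<epsilon> \<Longrightarrow> q t = p t"
proof -
  obtain \<epsilon> where \<epsilon>: "\<epsilon> > 0" "continuous_on {0..<\<epsilon>} p" "p 0 = 0" "\<forall>x\<in>{0..<\<epsilon>}. 0 \<le> p x"
    using assms unfolding gauge_fun_def by blast
  \<comment> \<open>A gauge representative is controlled only on \<open>{0..<\<epsilon>}\<close>.
    Freezing its argument at \<open>\<epsilon> / 2\<close>, a point inside that interval, extends it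
    continuously to all of \<open>{0..}\<close> without change near 0.\<close>
  define q where "q t = p (min t (\<epsilon> / 2))" for t
  have cont: "continuous_on {0..} q"
    unfolding q_def using \<epsilon>(1)
    by (intro continuous_on_compose2[OF \<epsilon>(2)] continuous_intros) auto
  have "(q \<longlongrightarrow> q 0) (at 0 within {0..})"
    using cont by (simp add: continuous_on_def)
  then have "(q \<longlongrightarrow> 0) (at_right 0)"
    using \<epsilon>(1,3) by (auto simp: q_def intro: tendsto_within_subset)
  moreover have "continuous_on {0<..} q"
    by (rule continuous_on_subset[OF cont]) auto
  ultimately have "nice_gauge q"
    using \<epsilon>(1,4) by (auto simp: nice_gauge_def q_def)
  then show thesis
    by (rule that[of q "\<epsilon> / 2"]) (use \<epsilon>(1) in \<open>auto simp: q_def\<close>)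
qed

lemma Baire_1_imp_gauge_limit:
  fixes f :: "'a::metric_space \<Rightarrow> real"
  assumes "Baire_1 f"
  shows "\<exists>F. continuous_on (UNIV \<times> {0<..}) F \<and> (\<forall>b. tends_along_gauge \<phi> F b (f b))"
  using assms
proof (transfer fixing: f)
  fix p assume "same_gauge_germ p p" and f: "Baire_1 f"
  then have "gauge_fun p"
    by (simp add: same_gauge_germ_def)
  then obtain q \<epsilon> where q: "nice_gauge q" and \<epsilon>: "\<epsilon> > 0" "\<And>t. 0 \<le> t \<Longrightarrow> t < \<epsilon> \<Longrightarrow> q t = p t"
    using gauge_fun_nice_representative by blast
  obtain F where F: "continuous_limit q F f"
    using Baire_1_continuous_limit[OF q f] by blast
  \<comment> \<open>Since \<open>q\<close> and \<open>p\<close> agree near 0, whatever holds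
    eventually along the filter of \<open>q\<close> does so along that of \<open>p\<close>; thus the
    limit constructed for \<open>q\<close> carries over to \<open>p\<close>.\<close>
  have "eventually P (gauge_filter p b)" if ev: "eventually P (gauge_filter q b)" for P and b :: 'a
  proof -
    obtain d where "d > 0" "\<forall>t b'. 0 < t \<and> t < d \<and> dist b b' \<le> q t \<longrightarrow> P (b', t)"
      using ev unfolding eventually_gauge_filter by blast
    then show ?thesis
      unfolding eventually_gauge_filter using \<epsilon> by (intro exI[of _ "min d \<epsilon>"]) auto
  qed
  then have "gauge_filter p b \<le> gauge_filter q b" for b :: 'a
    by (rule filter_leI)
  then have "(F \<longlongrightarrow> f b) (gauge_filter p b)" for b
    using F tendsto_mono unfolding continuous_limit_def by blast
  then show "\<exists>F. continuous_on (UNIV \<times> {0<..}) F \<and> (\<forall>b. \<forall>\<eta>>0. \<exists>\<delta>>0. \<forall>t b'.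
      0 < t \<and> t < \<delta> \<and> dist b b' \<le> p t \<longrightarrow> \<bar>F (b', t) - f b\<bar> < \<eta>)"
    using F unfolding continuous_limit_def tendsto_gauge_filter by blast
qed

text \<open>A smaller gauge has a smaller approach region near \<open>t = 0\<close>. This reduces an
  upper-bounded family to a single gauge, its bound.\<close>

lemma tends_along_gauge_antimono:
  assumes "\<phi> \<le> \<psi>" "tends_along_gauge \<psi> F b l"
  shows "tends_along_gauge \<phi> F b l"
  using assms
proof transfer
  fix p q and F :: "'a \<times> real \<Rightarrow> real" and b l
  assume "\<exists>\<epsilon>>0. \<forall>x\<in>{0..<\<epsilon>}. p x \<le> q x"
    and lim: "\<forall>\<eta>>0. \<exists>\<delta>>0. \<forall>t b'. 0 < t \<and> t < \<delta> \<and> dist b b' \<le> q t \<longrightarrow> \<bar>F (b', t) - l\<bar> < \<eta>"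
  then obtain \<epsilon> where \<epsilon>: "\<epsilon> > 0" "\<forall>x\<in>{0..<\<epsilon>}. p x \<le> q x" by blast
  show "\<forall>\<eta>>0. \<exists>\<delta>>0. \<forall>t b'. 0 < t \<and> t < \<delta> \<and> dist b b' \<le> p t \<longrightarrow> \<bar>F (b', t) - l\<bar> < \<eta>"
  proof (intro allI impI)
    fix \<eta> :: real assume "\<eta> > 0"
    then obtain d where "d > 0"
      "\<forall>t b'. 0 < t \<and> t < d \<and> dist b b' \<le> q t \<longrightarrow> \<bar>F (b', t) - l\<bar> < \<eta>"
      using lim by blast
    moreover have "dist b b' \<le> q t" if "0 < t" "t < \<epsilon>" "dist b b' \<le> p t" for t b'
      using \<epsilon>(2) that by (meson atLeastLessThan_iff less_imp_le order_trans)
    ultimately show "\<exists>\<delta>>0. \<forall>t b'. 0 < t \<and> t < \<delta> \<and> dist b b' \<le> p t \<longrightarrow> \<bar>F (b', t) - l\<bar> < \<eta>"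
      using \<epsilon>(1) by (intro exI[of _ "min d \<epsilon>"]) auto
  qed
qed

lemma tends_along_gauge_imp_seq:
  assumes "tends_along_gauge \<phi> F b l"
  shows "seq_tends_along_gauge \<phi> (\<lambda>n b'. F (b', 1 / real n)) b l"
  using assms
proof (transfer fixing: F b l)
  fix p
  assume lim: "\<forall>\<eta>>0. \<exists>\<delta>>0. \<forall>t b'. 0 < t \<and> t < \<delta> \<and> dist b b' \<le> p t \<longrightarrow> \<bar>F (b', t) - l\<bar> < \<eta>"
  show "\<forall>\<eta>>0. \<exists>N\<ge>1. \<forall>n b'. N \<le> n \<and> dist b b' \<le> p (1 / real n) \<longrightarrow>
      \<bar>F (b', 1 / real n) - l\<bar> < \<eta>"
  proof (intro allI impI)
    fix \<eta> :: real assume "\<eta> > 0"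
    then obtain \<delta> where "\<delta> > 0"
      and \<delta>: "\<forall>t b'. 0 < t \<and> t < \<delta> \<and> dist b b' \<le> p t \<longrightarrow> \<bar>F (b', t) - l\<bar> < \<eta>"
      using lim by meson
    \<comment> \<open>The threshold will be \<open>Suc k\<close>, so every \<open>n\<close> in
      question is positive and \<open>1 / real n\<close> is a genuine positive time.\<close>
    obtain k where k: "1 / real (Suc k) < \<delta>"
      using nat_approx_posE[OF \<open>\<delta> > 0\<close>] by blast
    have "0 < 1 / real n" "1 / real n < \<delta>" if "Suc k \<le> n" for n
    proof -
      show "0 < 1 / real n" using that by simp
      have "1 / real n \<le> 1 / real (Suc k)"
        using that by (intro divide_left_mono) auto
      then show "1 / real n < \<delta>" using k by linarith
    qed
    then have "\<forall>n b'. Suc k \<le> n \<and> dist b b' \<le> p (1 / real n) \<longrightarrow> \<bar>F (b', 1 / real n) - l\<bar> < \<eta>"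
      using \<delta> by metis
    then show "\<exists>N\<ge>1. \<forall>n b'. N \<le> n \<and> dist b b' \<le> p (1 / real n) \<longrightarrow>
        \<bar>F (b', 1 / real n) - l\<bar> < \<eta>"
      by (intro exI[of _ "Suc k"] conjI) auto
  qed
qed

text \<open>The point \<open>b' = b\<close> is admissible as soon as \<open>p (1 / real n)\<close>
  is nonnegative, which holds once \<open>1 / real n\<close> lies in the interval of the gauge. The
  shift by \<open>Suc\<close> drops the term at index 0, whose continuity is not guaranteed.\<close>

lemma seq_tends_along_gauge_imp_pointwise:
  assumes "seq_tends_along_gauge \<phi> F b l"
  shows "(\<lambda>n. F (Suc n) b) \<longlonglongrightarrow> l"
  using assms
proof transfer
  fix p and F :: "nat \<Rightarrow> 'a \<Rightarrow> real" and b l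
  assume "same_gauge_germ p p"
    and lim: "\<forall>\<eta>>0. \<exists>N\<ge>1. \<forall>n b'. N \<le> n \<and> dist b b' \<le> p (1 / real n) \<longrightarrow> \<bar>F n b' - l\<bar> < \<eta>"
  then obtain \<epsilon> where \<epsilon>: "\<epsilon> > 0" "\<forall>x\<in>{0..<\<epsilon>}. 0 \<le> p x"
    unfolding same_gauge_germ_def gauge_fun_def by blast
  obtain k where k: "1 / real (Suc k) < \<epsilon>"
    using nat_approx_posE[OF \<epsilon>(1)] by blast
  have p_nonneg: "0 \<le> p (1 / real n)" if "Suc k \<le> n" for n
  proof -
    have "1 / real n \<le> 1 / real (Suc k)"
      using that by (intro divide_left_mono) auto
    then show ?thesis using k \<epsilon>(2) by simp
  qed
  have "(\<lambda>n. F n b) \<longlonglongrightarrow> l"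
  proof (rule LIMSEQ_I)
    fix \<eta> :: real assume "\<eta> > 0"
    then obtain N where "\<forall>n b'. N \<le> n \<and> dist b b' \<le> p (1 / real n) \<longrightarrow> \<bar>F n b' - l\<bar> < \<eta>"
      using lim by blast
    then show "\<exists>N. \<forall>n\<ge>N. norm (F n b - l) < \<eta>"
      using p_nonneg by (intro exI[of _ "max N (Suc k)"]) auto
  qed
  then show "(\<lambda>n. F (Suc n) b) \<longlonglongrightarrow> l"
    by (rule LIMSEQ_Suc)
qed

section \<open>Implications between the conditions\<close>

lemma Baire_1_imp_boundary_limit:
  assumes "Baire_1 f" "bdd_above \<Phi>"
  shows "is_boundary_limit_of_continuous \<Phi> f"
proof -
  \<comment> \<open>One function constructed for the upper bound \<open>\<psi>\<close> serves all
    members of the family at once.\<close>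
  obtain \<psi> where \<psi>: "\<And>\<phi>. \<phi> \<in> \<Phi> \<Longrightarrow> \<phi> \<le> \<psi>"
    using assms(2) by (auto simp: bdd_above_def)
  obtain F where F: "continuous_on (UNIV \<times> {0<..}) F" "\<And>b. tends_along_gauge \<psi> F b (f b)"
    using Baire_1_imp_gauge_limit[OF assms(1), of \<psi>] by blast
  then show ?thesis
    unfolding is_boundary_limit_of_continuous_def has_boundary_limit_def
    using tends_along_gauge_antimono \<psi> by blast
qed

lemma boundary_limit_imp_seq_limit:
  assumes "is_boundary_limit_of_continuous \<Phi> f"
  shows "is_seq_limit_of_continuous \<Phi> f"
proof -
  obtain F where cont: "continuous_on (UNIV \<times> {0<..}) F" and F: "has_boundary_limit \<Phi> F f"
    using assms unfolding is_boundary_limit_of_continuous_def by blast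
  \<comment> \<open>Sampling at \<open>t = 1 / n\<close> stays in the region of continuity only for
    \<open>n \<ge> 1\<close>, as \<open>1 / real 0 = 0\<close>.\<close>
  have "continuous_on UNIV (\<lambda>b'. F (b', 1 / real n))" if "n \<ge> 1" for n
    using that by (intro continuous_on_compose2[OF cont] continuous_intros) auto
  moreover have "has_seq_limit \<Phi> (\<lambda>n b'. F (b', 1 / real n)) f"
    using F tends_along_gauge_imp_seq unfolding has_seq_limit_def has_boundary_limit_def by blast
  ultimately show ?thesis
    unfolding is_seq_limit_of_continuous_def by (intro exI conjI) auto
qed

lemma seq_limit_imp_Baire_1:
  assumes "is_seq_limit_of_continuous \<Phi> f" "\<Phi> \<noteq> {}"
  shows "Baire_1 f"
proof -
  obtain F \<phi> where F: "\<And>n. n \<ge> 1 \<Longrightarrow> continuous_on UNIV (F n)"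
    "\<And>b. seq_tends_along_gauge \<phi> F b (f b)"
    using assms unfolding is_seq_limit_of_continuous_def has_seq_limit_def by blast
  show ?thesis
    by (rule Baire_1_pointwise_limit[of "\<lambda>n. F (Suc n)"])
      (auto intro: F seq_tends_along_gauge_imp_pointwise)
qed

(* For the empty family every function is a limit of every function, so the "some" versions
   range over nonempty families. *)
theorem theorem2p2:
  fixes f :: "'a::metric_space \<Rightarrow> real"
  shows
    "((\<exists>\<Phi>. \<Phi> \<noteq> {} \<and> bdd_above \<Phi> \<and> is_boundary_limit_of_continuous \<Phi> f) \<longleftrightarrow> Baire_1 f) \<and>
     ((\<forall>\<Phi>. bdd_above \<Phi> \<longrightarrow> is_boundary_limit_of_continuous \<Phi> f) \<longleftrightarrow> Baire_1 f) \<and>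
     ((\<exists>\<phi>. is_boundary_limit_of_continuous {\<phi>} f) \<longleftrightarrow> Baire_1 f) \<and>
     ((\<forall>\<phi>. is_boundary_limit_of_continuous {\<phi>} f) \<longleftrightarrow> Baire_1 f) \<and>
     ((\<exists>\<Phi>. \<Phi> \<noteq> {} \<and> bdd_above \<Phi> \<and> is_seq_limit_of_continuous \<Phi> f) \<longleftrightarrow> Baire_1 f) \<and>
     ((\<forall>\<Phi>. bdd_above \<Phi> \<longrightarrow> is_seq_limit_of_continuous \<Phi> f) \<longleftrightarrow> Baire_1 f) \<and>
     ((\<exists>\<phi>. is_seq_limit_of_continuous {\<phi>} f) \<longleftrightarrow> Baire_1 f) \<and>
     ((\<forall>\<phi>. is_seq_limit_of_continuous {\<phi>} f) \<longleftrightarrow> Baire_1 f)"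
proof -
  \<comment> \<open>For a nonempty bounded family the cycle closes: boundary limit, sequential
    limit, Baire-1, boundary limit.\<close>
  have limit: "is_boundary_limit_of_continuous \<Phi> f \<longleftrightarrow> Baire_1 f"
    "is_seq_limit_of_continuous \<Phi> f \<longleftrightarrow> Baire_1 f" if "\<Phi> \<noteq> {}" "bdd_above \<Phi>" for \<Phi>
    using that Baire_1_imp_boundary_limit boundary_limit_imp_seq_limit seq_limit_imp_Baire_1
    by blast+
  have all: "is_boundary_limit_of_continuous \<Phi> f" "is_seq_limit_of_continuous \<Phi> f"
    if "Baire_1 f" "bdd_above \<Phi>" for \<Phi>
    using that Baire_1_imp_boundary_limit boundary_limit_imp_seq_limit by blast+
  have single: "{\<phi>} \<noteq> {}" "bdd_above {\<phi>}" for \<phi> :: smallness_gauge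
    by auto
  have singleton: "is_boundary_limit_of_continuous {\<phi>} f \<longleftrightarrow> Baire_1 f"
    "is_seq_limit_of_continuous {\<phi>} f \<longleftrightarrow> Baire_1 f" for \<phi>
    by (rule limit[OF single])+
  \<comment> \<open>Singletons are the witnesses for the existential version and the instances from
    which the universal one yields \<open>Baire_1 f\<close>. The second premise also covers the
    empty family, over which the universal version ranges.\<close>
  have some_family: "(\<exists>\<Phi>. \<Phi> \<noteq> {} \<and> bdd_above \<Phi> \<and> P \<Phi>) \<longleftrightarrow> Baire_1 f"
    and all_families: "(\<forall>\<Phi>. bdd_above \<Phi> \<longrightarrow> P \<Phi>) \<longleftrightarrow> Baire_1 f"
    if "\<And>\<Phi>. \<Phi> \<noteq> {} \<Longrightarrow> bdd_above \<Phi> \<Longrightarrow> P \<Phi> \<longleftrightarrow> Baire_1 f"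
      and "\<And>\<Phi>. Baire_1 f \<Longrightarrow> bdd_above \<Phi> \<Longrightarrow> P \<Phi>"
    for P :: "smallness_gauge set \<Rightarrow> bool"
  proof -
    show "(\<exists>\<Phi>. \<Phi> \<noteq> {} \<and> bdd_above \<Phi> \<and> P \<Phi>) \<longleftrightarrow> Baire_1 f"
      using that(1) single by meson
    show "(\<forall>\<Phi>. bdd_above \<Phi> \<longrightarrow> P \<Phi>) \<longleftrightarrow> Baire_1 f"
      using that single by meson
  qed
  show ?thesis
    unfolding singleton
    by (intro conjI some_family all_families limit all) simp_all
qed

end
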